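(* There is an absolute constant $c>0$ such that for all integers $d\geq 1$, $t\geq 5000$ and $m\geq 1$, $$R^{d,t}_2(3;m)\geq c\,(1681)^{m/7}\geq c\,(2.889)^m.$$
   Context: For a finite point set $P=\{p_1,\dots,p_N\}\subset\mathbb{R}^d$, a binary semi-algebraic relation $E\subset\binom{P}{2}$ of complexity at most $t$ is one for which there are $t$ polynomials $f_1,\dots,f_t\in\mathbb{R}[x_1,\dots,x_{2d}]$ of degree at most $t$ and a Boolean function $\Phi$ with $(p_i,p_j)\in E$ iff $\Phi(f_1(p_i,p_j)\ge0,\dots,f_t(p_i,p_j)\ge0)=1$ (for $i<j$); it is symmetric if this condition is invariant under swapping the two points. $R^{d,t}_2(3;m)$ is the minimum integer $N$ such that for every $N$-element point set $P\subset\mathbb{R}^d$ equipped with symmetric binary semi-algebraic relations $E_1,\dots,E_m\subset\binom{P}{2}$, each of complexity at most $t$, with $\binom{P}{2}=E_1\cup\dots\cup E_m$, there are three points of $P$ and an index $i$ such that all three pairs among them lie in $E_i$. *)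

theory Defs
  imports
    Complex_Main
    "HOL-Library.Ramsey"
    "HOL-Library.Poly_Mapping"
    "Jordan_Normal_Form.Matrix"
begin

text \<open>Real multivariate polynomials: the monomial \<open>a\<close> stands for \<open>\<Prod>i. x\<^sub>i ^ a\<^sub>i\<close>, and
  the variables are numbered from 0.\<close>

type_synonym real_mpoly = "(nat \<Rightarrow>\<^sub>0 nat) \<Rightarrow>\<^sub>0 real"

definition eval_mpoly :: "real_mpoly \<Rightarrow> real vec \<Rightarrow> real" where
  "eval_mpoly f v = (\<Sum>a\<in>Poly_Mapping.keys f. Poly_Mapping.lookup f a *
     (\<Prod>i\<in>Poly_Mapping.keys a. v $ i ^ Poly_Mapping.lookup a i))"

definition mpolys_deg_le :: "nat \<Rightarrow> nat \<Rightarrow> real_mpoly set" where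
  "mpolys_deg_le n t = {f. \<forall>a\<in>Poly_Mapping.keys f. Poly_Mapping.keys a \<subseteq> {..<n} \<and>
     (\<Sum>i\<in>Poly_Mapping.keys a. Poly_Mapping.lookup a i) \<le> t}"

definition sign_condition ::
    "real_mpoly list \<Rightarrow> (bool list \<Rightarrow> bool) \<Rightarrow> real vec \<Rightarrow> real vec \<Rightarrow> bool" where
  "sign_condition fs \<Phi> x y \<longleftrightarrow> \<Phi> (map (\<lambda>f. eval_mpoly f (x @\<^sub>v y) \<ge> 0) fs)"

text \<open>A point set \<open>P = {p\<^sub>1, \<dots>, p\<^sub>N}\<close> is given by the distinct list \<open>ps\<close> of its points, because
  the representation of a relation refers to the order of the points.\<close>

definition semialg_represents ::
    "nat \<Rightarrow> nat \<Rightarrow> real_mpoly list \<Rightarrow> (bool list \<Rightarrow> bool) \<Rightarrow> real vec list \<Rightarrow> real vec set set \<Rightarrow> bool" where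
  "semialg_represents d t fs \<Phi> ps E \<longleftrightarrow>
     length fs = t \<and> set fs \<subseteq> mpolys_deg_le (2 * d) t \<and>
     E \<subseteq> [set ps]\<^bsup>2\<^esup> \<and>
     (\<forall>i j. i < j \<and> j < length ps \<longrightarrow>
        ({ps ! i, ps ! j} \<in> E \<longleftrightarrow> sign_condition fs \<Phi> (ps ! i) (ps ! j)))"

definition symmetric_semialg ::
    "nat \<Rightarrow> nat \<Rightarrow> real vec list \<Rightarrow> real vec set set \<Rightarrow> bool" where
  "symmetric_semialg d t ps E \<longleftrightarrow>
     (\<exists>fs \<Phi>. semialg_represents d t fs \<Phi> ps E \<and>
       (\<forall>i j. i < j \<and> j < length ps \<longrightarrow>
          (sign_condition fs \<Phi> (ps ! i) (ps ! j) \<longleftrightarrow> sign_condition fs \<Phi> (ps ! j) (ps ! i))))"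

definition semialg_ramsey_property :: "nat \<Rightarrow> nat \<Rightarrow> nat \<Rightarrow> nat \<Rightarrow> bool" where
  "semialg_ramsey_property d t m N \<longleftrightarrow>
     (\<forall>ps E. distinct ps \<and> length ps = N \<and> set ps \<subseteq> carrier_vec d \<and>
        (\<forall>i\<in>{1..m}. symmetric_semialg d t ps (E i)) \<and>
        [set ps]\<^bsup>2\<^esup> = (\<Union>i\<in>{1..m}. E i) \<longrightarrow>
        (\<exists>T\<in>[set ps]\<^bsup>3\<^esup>. \<exists>i\<in>{1..m}. [T]\<^bsup>2\<^esup> \<subseteq> E i))"

definition semialg_ramsey :: "nat \<Rightarrow> nat \<Rightarrow> nat \<Rightarrow> nat" where
  "semialg_ramsey d t m = (LEAST N. semialg_ramsey_property d t m N)"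

text \<open>The minimum exists, by Ramsey's theorem.\<close>

lemma semialg_ramsey_property_ex: "\<exists>N. semialg_ramsey_property d t m N"
proof -
  obtain N :: nat where N: "partn_lst {..<N} (replicate m 3) 2"
    using ramsey_full by blast
  have "semialg_ramsey_property d t m N"
    unfolding semialg_ramsey_property_def
  proof (intro allI impI, elim conjE)
    fix ps :: "real vec list" and E :: "nat \<Rightarrow> real vec set set"
    assume ps: "distinct ps" "length ps = N"
      and cover: "[set ps]\<^bsup>2\<^esup> = (\<Union>i\<in>{1..m}. E i)"
    have inj: "inj_on ((!) ps) {..<N}"
      using ps by (auto simp: inj_on_def nth_eq_iff_index_eq)
    have sub: "(!) ps ` {..<N} \<subseteq> set ps"
      using ps by auto
    have img: "(!) ps ` S \<in> [set ps]\<^bsup>k\<^esup>" if "S \<in> [{..<N}]\<^bsup>k\<^esup>" for S k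
      using that sub by (auto simp: nsets_def card_image inj_on_subset[OF inj])
    have ex: "\<exists>i<m. (!) ps ` S \<in> E (Suc i)" if S: "S \<in> [{..<N}]\<^bsup>2\<^esup>" for S
    proof -
      from img[OF S] cover obtain j where "j \<in> {1..m}" "(!) ps ` S \<in> E j" by auto
      then show ?thesis by (intro exI[of _ "j - 1"]) auto
    qed
    then obtain c where c: "\<And>S. S \<in> [{..<N}]\<^bsup>2\<^esup> \<Longrightarrow> c S < m \<and> (!) ps ` S \<in> E (Suc (c S))"
      by metis
    have "c \<in> [{..<N}]\<^bsup>2\<^esup> \<rightarrow> {..<length (replicate m (3 :: nat))}"
      using c by auto
    from N[unfolded partn_lst_def monochromatic_def, rule_format, OF this] obtain i H where i: "i < m"
      and H: "H \<in> [{..<N}]\<^bsup>(replicate m 3 ! i)\<^esup>" and mono: "c ` ([H]\<^bsup>2\<^esup>) \<subseteq> {i}"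
      by (metis length_replicate lessThan_iff)
    have H3: "H \<in> [{..<N}]\<^bsup>3\<^esup>"
      using H i by simp
    have "[(!) ps ` H]\<^bsup>2\<^esup> \<subseteq> E (Suc i)"
    proof
      fix e assume "e \<in> [(!) ps ` H]\<^bsup>2\<^esup>"
      then obtain S where S: "S \<subseteq> H" "e = (!) ps ` S" and e: "card e = 2"
        by (auto simp: nsets_def subset_image_iff)
      have "H \<subseteq> {..<N}" "finite H" using H3 by (auto simp: nsets_def)
      then have "card S = 2" "finite S"
        using S e card_image[OF inj_on_subset[OF inj], of S] finite_subset by auto
      with S have "S \<in> [H]\<^bsup>2\<^esup>" by (auto simp: nsets_def)
      moreover from this have "S \<in> [{..<N}]\<^bsup>2\<^esup>"
        using nsets_mono[OF \<open>H \<subseteq> {..<N}\<close>] by blast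
      ultimately show "e \<in> E (Suc i)"
        using c[of S] mono S by auto
    qed
    then show "\<exists>T\<in>[set ps]\<^bsup>3\<^esup>. \<exists>i\<in>{1..m}. [T]\<^bsup>2\<^esup> \<subseteq> E i"
      using img[OF H3] i by (intro bexI[of _ "(!) ps ` H"] bexI[of _ "Suc i"]) auto
  qed
  then show ?thesis ..
qed

end

theory Submission
  imports Defs
begin

text \<open>A Schur colouring of \<open>{1..M}\<close> with \<open>n\<close> colours gives, for every \<open>k\<close>, a triangle-free
  colouring with \<open>n k\<close> colours of the \<open>(M + 1)\<^sup>k\<close> reals with \<open>k\<close> digits in \<open>{0..M}\<close> to the base
  \<open>B = 4 (M + 1)\<close>: the colour of a pair is the leading position \<open>l\<close> at which the digits differ
  together with the Schur colour of the difference \<open>s\<close> of the digits there. The distance of the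
  two points is then close to \<open>s B\<^sup>l\<close>, so a colour class is a finite union of conditions that the
  squared distance lies in a given interval. One polynomial of degree at most \<open>t\<close> tests \<open>t div 4\<close>
  of these intervals, so \<open>t \<ge> 5000\<close> leaves room for more than six million values of \<open>s\<close>. This
  allows the 12-colouring of \<open>{1..352484}\<close> obtained as a threefold product of a 4-colouring of
  \<open>{1..44}\<close>, and it suffices because \<open>352485\<^sup>7 \<ge> 1681\<^sup>1\<^sup>2\<close>; no Schur
  colouring of \<open>{1..1680}\<close> with 7 colours is needed.\<close>

section \<open>Evaluation of polynomials\<close>

definition eval_monom :: "(nat \<Rightarrow>\<^sub>0 nat) \<Rightarrow> real vec \<Rightarrow> real" where
  "eval_monom a v = (\<Prod>i\<in>Poly_Mapping.keys a. v $ i ^ Poly_Mapping.lookup a i)"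

lemma eval_monom_superset:
  assumes "finite S" "Poly_Mapping.keys a \<subseteq> S"
  shows "eval_monom a v = (\<Prod>i\<in>S. v $ i ^ Poly_Mapping.lookup a i)"
  unfolding eval_monom_def using assms
  by (intro prod.mono_neutral_left) (auto simp: in_keys_iff)

lemma eval_monom_add: "eval_monom (a + b) v = eval_monom a v * eval_monom b v"
proof -
  let ?S = "Poly_Mapping.keys a \<union> Poly_Mapping.keys b"
  have "Poly_Mapping.keys (a + b) \<subseteq> ?S"
    by (rule keys_add)
  then show ?thesis
    by (simp add: eval_monom_superset[of ?S] lookup_add power_add prod.distrib)
qed

text \<open>Absent monomials have coefficient 0. A common index set is convenient because
  cancellation can make \<open>keys (f + g)\<close> smaller than the union of the keys.\<close>

lemma eval_mpoly_superset:
  assumes "finite S" "Poly_Mapping.keys f \<subseteq> S"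
  shows "eval_mpoly f v = (\<Sum>a\<in>S. Poly_Mapping.lookup f a * eval_monom a v)"
  unfolding eval_mpoly_def eval_monom_def[symmetric] using assms
  by (intro sum.mono_neutral_left) (auto simp: in_keys_iff)

lemma eval_mpoly_add: "eval_mpoly (f + g) v = eval_mpoly f v + eval_mpoly g v"
proof -
  let ?S = "Poly_Mapping.keys f \<union> Poly_Mapping.keys g"
  have "Poly_Mapping.keys (f + g) \<subseteq> ?S"
    by (rule keys_add)
  then show ?thesis
    by (simp add: eval_mpoly_superset[of ?S] lookup_add distrib_right sum.distrib)
qed

lemma eval_mpoly_zero [simp]: "eval_mpoly 0 v = 0"
  by (simp add: eval_mpoly_def)

lemma eval_mpoly_single [simp]: "eval_mpoly (Poly_Mapping.single a c) v = c * eval_monom a v"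
  by (subst eval_mpoly_superset[of "{a}"]) auto

lemma eval_mpoly_sum: "eval_mpoly (sum f S) v = (\<Sum>i\<in>S. eval_mpoly (f i) v)"
  by (induction S rule: infinite_finite_induct) (auto simp: eval_mpoly_add)

lemma eval_mpoly_diff: "eval_mpoly (f - g) v = eval_mpoly f v - eval_mpoly g v"
  using eval_mpoly_add[of "f - g" g v] by simp

lemma poly_mapping_sum_single:
  "(\<Sum>a\<in>Poly_Mapping.keys f. Poly_Mapping.single a (Poly_Mapping.lookup f a)) = f"
  by (rule poly_mapping_eqI)
    (auto simp: lookup_sum lookup_single when_def sum.delta in_keys_iff)

text \<open>Both factors are expanded into single terms, whose product adds exponents and multiplies
  coefficients; \<open>eval_monom_add\<close> then splits each summand.\<close>

lemma eval_mpoly_mult: "eval_mpoly (f * g) v = eval_mpoly f v * eval_mpoly g v"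
proof -
  let ?s = "\<lambda>f a. Poly_Mapping.single a (Poly_Mapping.lookup f a)"
  let ?K = "Poly_Mapping.keys"
  have "f * g = (\<Sum>a\<in>?K f. ?s f a) * (\<Sum>b\<in>?K g. ?s g b)"
    by (simp only: poly_mapping_sum_single)
  also have "\<dots> = (\<Sum>a\<in>?K f. \<Sum>b\<in>?K g. ?s f a * ?s g b)"
    by (rule sum_product)
  finally have "f * g = (\<Sum>a\<in>?K f. \<Sum>b\<in>?K g. ?s f a * ?s g b)" .
  then have "eval_mpoly (f * g) v =
      (\<Sum>a\<in>?K f. \<Sum>b\<in>?K g. eval_mpoly (?s f a * ?s g b) v)"
    by (simp only: eval_mpoly_sum)
  also have "\<dots> = (\<Sum>a\<in>?K f. \<Sum>b\<in>?K g.
      (Poly_Mapping.lookup f a * eval_monom a v) * (Poly_Mapping.lookup g b * eval_monom b v))"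
    by (simp add: mult_single eval_monom_add mult_ac)
  also have "\<dots> = eval_mpoly f v * eval_mpoly g v"
    unfolding eval_mpoly_superset[OF finite_keys subset_refl] by (rule sum_product[symmetric])
  finally show ?thesis .
qed

lemma eval_mpoly_one [simp]: "eval_mpoly 1 v = 1"
  by (simp add: single_one[symmetric] eval_monom_def del: single_one)

lemma eval_mpoly_prod: "eval_mpoly (prod f S) v = (\<Prod>i\<in>S. eval_mpoly (f i) v)"
  by (induction S rule: infinite_finite_induct) (auto simp: eval_mpoly_mult)

section \<open>Degree bounds\<close>

definition total_deg :: "(nat \<Rightarrow>\<^sub>0 nat) \<Rightarrow> nat" where
  "total_deg a = (\<Sum>i\<in>Poly_Mapping.keys a. Poly_Mapping.lookup a i)"

lemma total_deg_superset:
  assumes "finite S" "Poly_Mapping.keys a \<subseteq> S"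
  shows "total_deg a = (\<Sum>i\<in>S. Poly_Mapping.lookup a i)"
  unfolding total_deg_def using assms
  by (intro sum.mono_neutral_left) (auto simp: in_keys_iff)

lemma total_deg_add: "total_deg (a + b) = total_deg a + total_deg b"
proof -
  let ?S = "Poly_Mapping.keys a \<union> Poly_Mapping.keys b"
  have "Poly_Mapping.keys (a + b) \<subseteq> ?S"
    by (rule keys_add)
  then show ?thesis
    by (simp add: total_deg_superset[of ?S] lookup_add sum.distrib)
qed

lemma mpolys_deg_le_iff:
  "f \<in> mpolys_deg_le n t \<longleftrightarrow>
     (\<forall>a\<in>Poly_Mapping.keys f. Poly_Mapping.keys a \<subseteq> {..<n} \<and> total_deg a \<le> t)"
  by (simp add: mpolys_deg_le_def total_deg_def)

lemma mpolys_deg_le_mono: "f \<in> mpolys_deg_le n s \<Longrightarrow> s \<le> t \<Longrightarrow> f \<in> mpolys_deg_le n t"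
  by (auto simp: mpolys_deg_le_iff)

lemma mpolys_deg_le_diff:
  "f \<in> mpolys_deg_le n t \<Longrightarrow> g \<in> mpolys_deg_le n t \<Longrightarrow> f - g \<in> mpolys_deg_le n t"
  using keys_diff[of f g] unfolding mpolys_deg_le_iff by blast

lemma mpolys_deg_le_mult:
  assumes "f \<in> mpolys_deg_le n s" "g \<in> mpolys_deg_le n t"
  shows "f * g \<in> mpolys_deg_le n (s + t)"
  unfolding mpolys_deg_le_iff
proof
  fix c assume "c \<in> Poly_Mapping.keys (f * g)"
  then obtain a b where c: "c = a + b" and a: "a \<in> Poly_Mapping.keys f" and b: "b \<in> Poly_Mapping.keys g"
    using keys_mult[of f g] by blast
  have "Poly_Mapping.keys a \<subseteq> {..<n}" "total_deg a \<le> s"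
    "Poly_Mapping.keys b \<subseteq> {..<n}" "total_deg b \<le> t"
    using assms a b by (auto simp: mpolys_deg_le_iff)
  then show "Poly_Mapping.keys c \<subseteq> {..<n} \<and> total_deg c \<le> s + t"
    using keys_add[of a b] unfolding c total_deg_add by auto
qed

lemma mpolys_deg_le_const: "Poly_Mapping.single 0 c \<in> mpolys_deg_le n t"
  by (auto simp: mpolys_deg_le_iff total_deg_def)

lemma mpolys_deg_le_one: "1 \<in> mpolys_deg_le n t"
  using mpolys_deg_le_const[of 1 n t] by simp

lemma mpolys_deg_le_prod:
  assumes "\<And>i. i \<in> S \<Longrightarrow> f i \<in> mpolys_deg_le n k"
  shows "prod f S \<in> mpolys_deg_le n (k * card S)"
  using assms
proof (induction S rule: infinite_finite_induct)
  case (insert i S)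
  then have "f i * prod f S \<in> mpolys_deg_le n (k + k * card S)"
    by (intro mpolys_deg_le_mult) auto
  with insert show ?case by simp
qed (auto intro: mpolys_deg_le_one)

definition mpoly_var :: "nat \<Rightarrow> real_mpoly" where
  "mpoly_var i = Poly_Mapping.single (Poly_Mapping.single i 1) 1"

lemma eval_mpoly_var [simp]: "eval_mpoly (mpoly_var i) v = v $ i"
  by (simp add: mpoly_var_def eval_monom_def)

lemma mpoly_var_deg: "i < n \<Longrightarrow> mpoly_var i \<in> mpolys_deg_le n 1"
  by (auto simp: mpoly_var_def mpolys_deg_le_iff total_deg_def)

section \<open>Approximate distances as a semi-algebraic relation\<close>

text \<open>A tolerance of half the spacing makes the windows around distinct multiples
  disjoint.\<close>

definition near_multiple :: "nat set \<Rightarrow> real \<Rightarrow> real \<Rightarrow> bool" where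
  "near_multiple A \<beta> u \<longleftrightarrow> (\<exists>s\<in>A. \<bar>u - real s * \<beta>\<bar> < \<beta> / 2)"

text \<open>A quadratic in \<open>w\<^sup>2\<close> whose roots are the squared end points of the
  interval around \<open>s * \<beta>\<close>. Squares replace the absolute value by a polynomial and
  keep the condition symmetric in the two points.\<close>

definition window :: "real \<Rightarrow> nat \<Rightarrow> real \<Rightarrow> real" where
  "window \<beta> s w = (w\<^sup>2 - ((real s - 1/2) * \<beta>)\<^sup>2) * (w\<^sup>2 - ((real s + 1/2) * \<beta>)\<^sup>2)"

lemma window_neg_iff:
  assumes "\<beta> > 0" "s \<ge> 1"
  shows "window \<beta> s w < 0 \<longleftrightarrow> \<bar>\<bar>w\<bar> - real s * \<beta>\<bar> < \<beta> / 2"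
proof -
  define a b where "a = (real s - 1/2) * \<beta>" and "b = (real s + 1/2) * \<beta>"
  have ab: "0 < a" "a < b"
    using assms by (auto simp: a_def b_def)
  have a: "w\<^sup>2 < a\<^sup>2 \<longleftrightarrow> \<bar>w\<bar> < a" "a\<^sup>2 < w\<^sup>2 \<longleftrightarrow> a < \<bar>w\<bar>"
    using ab abs_le_square_iff[of w a] abs_le_square_iff[of a w] by (auto simp: not_le[symmetric])
  have b: "w\<^sup>2 < b\<^sup>2 \<longleftrightarrow> \<bar>w\<bar> < b" "b\<^sup>2 < w\<^sup>2 \<longleftrightarrow> b < \<bar>w\<bar>"
    using ab abs_le_square_iff[of w b] abs_le_square_iff[of b w] by (auto simp: not_le[symmetric])
  have "window \<beta> s w < 0 \<longleftrightarrow> a < \<bar>w\<bar> \<and> \<bar>w\<bar> < b"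
    unfolding window_def a_def[symmetric] b_def[symmetric] mult_less_0_iff using a b ab by auto
  also have "\<dots> \<longleftrightarrow> \<bar>\<bar>w\<bar> - real s * \<beta>\<bar> < \<beta> / 2"
    unfolding a_def b_def left_diff_distrib distrib_right abs_diff_less_iff by auto
  finally show ?thesis .
qed

text \<open>In the open window of \<open>s\<close>, \<open>\<bar>w\<bar>\<close> lies strictly
  beyond both end points of any other window, on the same side, so the two factors have equal
  sign.\<close>

lemma window_pos:
  assumes "\<beta> > 0" "s' \<ge> 1" "s \<noteq> s'" "\<bar>\<bar>w\<bar> - real s * \<beta>\<bar> < \<beta> / 2"
  shows "window \<beta> s' w > 0"
proof -
  have lu: "(real s - 1/2) * \<beta> < \<bar>w\<bar>" "\<bar>w\<bar> < (real s + 1/2) * \<beta>"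
    using assms(4) unfolding left_diff_distrib distrib_right abs_diff_less_iff by auto
  show ?thesis
  proof (cases "s < s'")
    case True
    then have "(real s + 1/2) * \<beta> \<le> (real s' - 1/2) * \<beta>"
      using assms(1) by (intro mult_right_mono) auto
    moreover have "(real s' - 1/2) * \<beta> \<le> (real s' + 1/2) * \<beta>"
      using assms(1) by (intro mult_right_mono) auto
    ultimately have "w\<^sup>2 < ((real s' - 1/2) * \<beta>)\<^sup>2" "w\<^sup>2 < ((real s' + 1/2) * \<beta>)\<^sup>2"
      using lu by (auto intro!: power2_strict_mono)
    then show ?thesis
      unfolding window_def by (intro mult_neg_neg) auto
  next
    case False
    then have "(real s' + 1/2) * \<beta> \<le> (real s - 1/2) * \<beta>"
      using assms(1,3) by (intro mult_right_mono) auto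
    moreover have "(real s' - 1/2) * \<beta> \<le> (real s' + 1/2) * \<beta>" "0 \<le> (real s' - 1/2) * \<beta>"
      using assms(1,2) by (auto intro!: mult_right_mono)
    ultimately have "((real s' - 1/2) * \<beta>)\<^sup>2 < w\<^sup>2" "((real s' + 1/2) * \<beta>)\<^sup>2 < w\<^sup>2"
      using lu by (auto intro!: power2_strict_mono)
    then show ?thesis
      unfolding window_def by (intro mult_pos_pos) auto
  qed
qed

text \<open>Inside one window exactly one factor is negative and all others are positive. For
  \<open>s = 0\<close> the factor is a square and never negative, hence
  \<open>0 \<notin> A\<close>.\<close>

lemma prod_window_neg_iff:
  assumes "\<beta> > 0" "finite A" "0 \<notin> A"
  shows "(\<Prod>s\<in>A. window \<beta> s w) < 0 \<longleftrightarrow> near_multiple A \<beta> \<bar>w\<bar>"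
proof
  assume "near_multiple A \<beta> \<bar>w\<bar>"
  then obtain s where s: "s \<in> A" "\<bar>\<bar>w\<bar> - real s * \<beta>\<bar> < \<beta> / 2"
    by (auto simp: near_multiple_def)
  have "window \<beta> s w < 0"
    using assms s by (subst window_neg_iff) (auto simp: Suc_le_eq intro: gr0I)
  moreover have "(\<Prod>s\<in>A - {s}. window \<beta> s w) > 0"
    using assms s by (intro prod_pos window_pos[where s = s]) (auto simp: Suc_le_eq intro: gr0I)
  ultimately show "(\<Prod>s\<in>A. window \<beta> s w) < 0"
    using assms s(1) by (subst prod.remove[of _ s]) (auto intro: mult_neg_pos)
next
  assume "(\<Prod>s\<in>A. window \<beta> s w) < 0"
  then obtain s where "s \<in> A" "window \<beta> s w < 0"
    by (meson prod_nonneg not_le)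
  then show "near_multiple A \<beta> \<bar>w\<bar>"
    using assms window_neg_iff[of \<beta> s w] unfolding near_multiple_def
    by (metis Suc_leI gr0I One_nat_def)
qed

text \<open>Variables \<open>0\<close> and \<open>d\<close> are the first coordinates of the two
  concatenated points.\<close>

definition diff_sq_mpoly :: "nat \<Rightarrow> real \<Rightarrow> real_mpoly" where
  "diff_sq_mpoly d a = (mpoly_var 0 - mpoly_var d) * (mpoly_var 0 - mpoly_var d) - Poly_Mapping.single 0 (a\<^sup>2)"

lemma eval_diff_sq_mpoly:
  assumes "x \<in> carrier_vec d" "y \<in> carrier_vec d" "d \<ge> 1"
  shows "eval_mpoly (diff_sq_mpoly d a) (x @\<^sub>v y) = (x $ 0 - y $ 0)\<^sup>2 - a\<^sup>2"
proof -
  have "(x @\<^sub>v y) $ 0 = x $ 0" "(x @\<^sub>v y) $ d = y $ 0"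
    using assms by (auto simp: append_vec_def Let_def)
  then show ?thesis
    by (simp add: diff_sq_mpoly_def eval_mpoly_diff eval_mpoly_mult eval_monom_def power2_eq_square)
qed

lemma diff_sq_mpoly_deg: "d \<ge> 1 \<Longrightarrow> diff_sq_mpoly d a \<in> mpolys_deg_le (2 * d) 2"
proof -
  assume d: "d \<ge> 1"
  then have "mpoly_var 0 - mpoly_var d \<in> mpolys_deg_le (2 * d) 1"
    by (intro mpolys_deg_le_diff mpoly_var_deg) auto
  then have "(mpoly_var 0 - mpoly_var d) * (mpoly_var 0 - mpoly_var d) \<in> mpolys_deg_le (2 * d) (1 + 1)"
    by (intro mpolys_deg_le_mult)
  then show ?thesis
    unfolding diff_sq_mpoly_def
    by (intro mpolys_deg_le_diff mpolys_deg_le_const) (simp add: numeral_2_eq_2)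
qed

definition window_mpoly :: "nat \<Rightarrow> real \<Rightarrow> nat set \<Rightarrow> real_mpoly" where
  "window_mpoly d \<beta> A =
     (\<Prod>s\<in>A. diff_sq_mpoly d ((real s - 1/2) * \<beta>) * diff_sq_mpoly d ((real s + 1/2) * \<beta>))"

lemma eval_window_mpoly:
  assumes "x \<in> carrier_vec d" "y \<in> carrier_vec d" "d \<ge> 1"
  shows "eval_mpoly (window_mpoly d \<beta> A) (x @\<^sub>v y) = (\<Prod>s\<in>A. window \<beta> s (x $ 0 - y $ 0))"
  using assms
  by (simp add: window_mpoly_def window_def eval_mpoly_prod eval_mpoly_mult eval_diff_sq_mpoly)

lemma window_mpoly_deg:
  assumes "d \<ge> 1"
  shows "window_mpoly d \<beta> A \<in> mpolys_deg_le (2 * d) (4 * card A)"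
proof -
  have "diff_sq_mpoly d a * diff_sq_mpoly d b \<in> mpolys_deg_le (2 * d) (2 + 2)" for a b
    by (intro mpolys_deg_le_mult diff_sq_mpoly_deg assms)
  then show ?thesis
    unfolding window_mpoly_def by (intro mpolys_deg_le_prod) simp
qed

definition dist_relation :: "real vec set \<Rightarrow> nat set \<Rightarrow> real \<Rightarrow> real vec set set" where
  "dist_relation P A \<beta> =
     {{x, y} | x y. x \<in> P \<and> y \<in> P \<and> x \<noteq> y \<and> near_multiple A \<beta> \<bar>x $ 0 - y $ 0\<bar>}"

lemma dist_relation_iff:
  assumes "x \<in> P" "y \<in> P" "x \<noteq> y"
  shows "{x, y} \<in> dist_relation P A \<beta> \<longleftrightarrow> near_multiple A \<beta> \<bar>x $ 0 - y $ 0\<bar>"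
  using assms by (auto simp: dist_relation_def doubleton_eq_iff abs_minus_commute)

text \<open>Cutting \<open>A\<close> into \<open>t\<close> blocks of at most \<open>t div 4\<close> elements balances the number of
  polynomials against their degree, so that about \<open>t\<^sup>2 / 4\<close> windows can be recognised.\<close>

lemma dist_relation_symmetric_semialg:
  assumes d: "d \<ge> 1" and \<beta>: "\<beta> > 0" and A: "0 \<notin> A" "A \<subseteq> {..<t * (t div 4)}"
    and ps: "distinct ps" "set ps \<subseteq> carrier_vec d"
  shows "symmetric_semialg d t ps (dist_relation (set ps) A \<beta>)"
proof -
  define b where "b = t div 4"
  define C where "C q = {s \<in> A. s div b = q}" for q
  define fs where "fs = map (\<lambda>q. window_mpoly d \<beta> (C q)) [0..<t]"
  \<comment> \<open>An entry is \<open>False\<close> when the product of its block is negative, that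
    is, when the distance lies in a window of that block.\<close>
  define \<Phi> where "\<Phi> bs \<longleftrightarrow> False \<in> set bs" for bs :: "bool list"
  have finA: "finite A"
    using A(2) by (rule finite_subset) simp
  have C: "finite (C q)" "0 \<notin> C q" for q
    using finA A(1) by (auto simp: C_def)
  have cardC: "4 * card (C q) \<le> t" for q
  \<comment> \<open>For \<open>t < 4\<close> the block length is 0, and the bound on
    \<open>A\<close> forces \<open>A = {}\<close>.\<close>
  proof (cases "b = 0")
    case True
    then have "A = {}" using A(2) by (auto simp: b_def)
    then show ?thesis by (simp add: C_def)
  next
    case False
    have "C q \<subseteq> {q * b..<q * b + b}"
      using False dividend_less_div_times[of b] by (auto simp: C_def add.commute)
    then have "card (C q) \<le> b"
      using card_mono[of "{q * b..<q * b + b}" "C q"] by simp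
    then show ?thesis by (simp add: b_def)
  qed
  have mem: "near_multiple A \<beta> u \<longleftrightarrow> (\<exists>q<t. near_multiple (C q) \<beta> u)" for u
  proof -
    have "s div b < t" if "s \<in> A" for s
      using A(2) that unfolding b_def[symmetric] by (auto intro: less_mult_imp_div_less)
    then show ?thesis by (auto simp: near_multiple_def C_def)
  qed
  have sc: "sign_condition fs \<Phi> x y \<longleftrightarrow> near_multiple A \<beta> \<bar>x $ 0 - y $ 0\<bar>"
    if "x \<in> carrier_vec d" "y \<in> carrier_vec d" for x y
  proof -
    have "sign_condition fs \<Phi> x y \<longleftrightarrow> (\<exists>q<t. (\<Prod>s\<in>C q. window \<beta> s (x $ 0 - y $ 0)) < 0)"
      by (auto simp: sign_condition_def \<Phi>_def fs_def eval_window_mpoly[OF that d] image_iff not_le)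
    then show ?thesis
      by (simp only: prod_window_neg_iff[OF \<beta> C] mem)
  qed
  have "semialg_represents d t fs \<Phi> ps (dist_relation (set ps) A \<beta>)"
    unfolding semialg_represents_def
  proof (intro conjI allI impI)
    show "length fs = t" by (simp add: fs_def)
    show "set fs \<subseteq> mpolys_deg_le (2 * d) t"
      using mpolys_deg_le_mono[OF window_mpoly_deg[OF d] cardC] by (auto simp: fs_def)
    show "dist_relation (set ps) A \<beta> \<subseteq> [set ps]\<^bsup>2\<^esup>"
      by (auto simp: dist_relation_def nsets_def)
    fix i j assume "i < j \<and> j < length ps"
    then have "ps ! i \<in> set ps" "ps ! j \<in> set ps" "ps ! i \<noteq> ps ! j"
      using ps(1) by (auto simp: nth_eq_iff_index_eq)
    then show "{ps ! i, ps ! j} \<in> dist_relation (set ps) A \<beta> \<longleftrightarrow> sign_condition fs \<Phi> (ps ! i) (ps ! j)"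
      using ps(2) by (subst sc) (auto simp: dist_relation_iff)
  qed
  moreover have "sign_condition fs \<Phi> (ps ! i) (ps ! j) \<longleftrightarrow> sign_condition fs \<Phi> (ps ! j) (ps ! i)"
    if "i < j \<and> j < length ps" for i j
  proof -
    have "ps ! i \<in> carrier_vec d" "ps ! j \<in> carrier_vec d"
      using ps(2) that by auto
    then show ?thesis by (simp add: sc abs_minus_commute)
  qed
  ultimately show ?thesis
    unfolding symmetric_semialg_def by blast
qed

section \<open>Schur colourings\<close>

definition schur_colouring :: "nat \<Rightarrow> nat \<Rightarrow> (nat \<Rightarrow> nat) \<Rightarrow> bool" where
  "schur_colouring n M \<chi> \<longleftrightarrow> (\<forall>x\<in>{1..M}. \<chi> x < n) \<and>
     (\<forall>x y. 1 \<le> x \<and> 1 \<le> y \<and> x + y \<le> M \<and> \<chi> x = \<chi> y \<longrightarrow> \<chi> (x + y) \<noteq> \<chi> x)"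

text \<open>With \<open>L = 2 * a + 1\<close>, residues in \<open>{1..a}\<close> modulo
  \<open>L\<close> are coloured by \<chi>; every other number is at most \<open>a\<close> below a
  multiple of \<open>L\<close> and is coloured by \<psi> of the quotient. The bound is
  \<open>b * L + a\<close>, after which the rounded quotient would be \<open>b + 1\<close>.\<close>

lemma schur_colouring_product:
  assumes \<chi>: "schur_colouring n a \<chi>" and \<psi>: "schur_colouring k b \<psi>"
  shows "\<exists>\<phi>. schur_colouring (n + k) (2 * a * b + a + b) \<phi>"
proof -
  define L where "L = 2 * a + 1"
  define lo where "lo x \<longleftrightarrow> 1 \<le> x mod L \<and> x mod L \<le> a" for x
  \<comment> \<open>The quotient rounded up: outside \<open>lo\<close> the remainder counts as lying in \<open>{-a..0}\<close>.\<close>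
  define up where "up x = (x + a) div L" for x
  define \<phi> where "\<phi> x = (if lo x then \<chi> (x mod L) else n + \<psi> (up x))" for x
  have L: "L > 0" by (simp add: L_def)
  have up_range: "1 \<le> up x \<and> up x \<le> b" if "\<not> lo x" "1 \<le> x" "x \<le> 2 * a * b + a + b" for x
  proof
    have "x \<ge> a + 1"
    proof (rule ccontr)
      assume "\<not> x \<ge> a + 1"
      then have "x mod L = x" by (simp add: L_def)
      with that \<open>\<not> x \<ge> a + 1\<close> show False by (simp add: lo_def)
    qed
    then have "L \<le> x + a" by (simp add: L_def)
    then show "1 \<le> up x"
      unfolding up_def using div_le_mono[of L "x + a" L] L by simp
    have "x + a < (b + 1) * L"
      using that(3) by (simp add: L_def algebra_simps)
    then have "up x < b + 1"
      unfolding up_def by (rule less_mult_imp_div_less)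
    then show "up x \<le> b" by simp
  qed
  have decomp: "\<exists>r\<le>a. x + r = up x * L" if "\<not> lo x" for x
  proof -
    have m: "x mod L < L" using L by simp
    have e: "x = x div L * L + x mod L" by simp
    show ?thesis
    proof (cases "x mod L = 0")
      case True
      then have "x + a = a + x div L * L" using e by simp
      then have "up x = x div L"
        unfolding up_def using L by (simp only: div_mult_self1) (simp add: L_def)
      with True e show ?thesis by (intro exI[of _ 0]) auto
    next
      case False
      with that have g: "x mod L > a" by (auto simp: lo_def)
      then have "x + a = (x div L + 1) * L + (x mod L - a - 1)"
        using e by (simp add: L_def algebra_simps)
      moreover have "x mod L - a - 1 < L" using m by simp
      ultimately have "up x = x div L + 1"
        unfolding up_def using L by (simp only: div_mult_self3) simp
      then have "up x * L = x div L * L + L"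
        by (simp add: algebra_simps)
      then have "x + (L - x mod L) = up x * L"
        using e m by linarith
      moreover have "L - x mod L \<le> a" using g by (simp add: L_def)
      ultimately show ?thesis by blast
    qed
  qed
  have "schur_colouring (n + k) (2 * a * b + a + b) \<phi>"
    unfolding schur_colouring_def
  proof (intro conjI ballI allI impI, goal_cases)
    case (1 x)
    show ?case
    proof (cases "lo x")
      case True
      then show ?thesis using \<chi> by (auto simp: \<phi>_def lo_def schur_colouring_def trans_less_add1)
    next
      case False
      then show ?thesis using \<psi> up_range[of x] 1 by (auto simp: \<phi>_def schur_colouring_def)
    qed
  next
    case (2 x y)
    then have x: "1 \<le> x" "x \<le> 2 * a * b + a + b" and y: "1 \<le> y" "y \<le> 2 * a * b + a + b"
      and z: "1 \<le> x + y" "x + y \<le> 2 * a * b + a + b" and eq: "\<phi> x = \<phi> y"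
      by auto
    \<comment> \<open>Low numbers get colours below \<open>n\<close> and the others colours from
      \<open>n\<close> on, so equal colours put \<open>x\<close>, \<open>y\<close> and
      \<open>x + y\<close> into the same case.\<close>
    have low: "\<phi> w < n" if "lo w" for w
      using that \<chi> by (auto simp: \<phi>_def lo_def schur_colouring_def)
    have high: "n \<le> \<phi> w" if "\<not> lo w" for w
      using that by (auto simp: \<phi>_def)
    show ?case
    proof
      assume eq': "\<phi> (x + y) = \<phi> x"
      show False
      proof (cases "lo x")
        case True
        then have los: "lo x" "lo y" "lo (x + y)"
          using low high eq eq' by (metis not_le)+
        \<comment> \<open>Two residues of at most \<open>a\<close> add up to at most
          \<open>2 * a < L\<close>, so there is no carry.\<close>
        have "(x + y) mod L = (x mod L + y mod L) mod L" by (simp add: mod_add_eq)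
        also have "\<dots> = x mod L + y mod L"
          using los by (intro mod_less) (auto simp: lo_def L_def)
        finally have s: "(x + y) mod L = x mod L + y mod L" .
        have "\<chi> (x mod L) = \<chi> (y mod L)" "\<chi> (x mod L + y mod L) = \<chi> (x mod L)"
          using los eq eq' s by (auto simp: \<phi>_def)
        moreover have "1 \<le> x mod L" "1 \<le> y mod L" "x mod L + y mod L \<le> a"
          using los s by (auto simp: lo_def)
        ultimately show False
          using \<chi> unfolding schur_colouring_def by blast
      next
        case False
        then have his: "\<not> lo x" "\<not> lo y" "\<not> lo (x + y)"
          using low high eq eq' by (metis not_le)+
        from decomp[OF his(1)] decomp[OF his(2)] decomp[OF his(3)] obtain r1 r2 r3
          where r: "r1 \<le> a" "r2 \<le> a" "r3 \<le> a"
          and e: "x + r1 = up x * L" "y + r2 = up y * L" "x + y + r3 = up (x + y) * L"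
          by blast
        have e': "up (x + y) * L + r1 + r2 = (up x + up y) * L + r3"
          using e by (simp add: algebra_simps)
        \<comment> \<open>By \<open>e'\<close>, \<open>r3 - r1 - r2\<close> is a multiple of
          \<open>L\<close>; it lies between \<open>- 2 * a\<close> and \<open>a\<close>, so it is
          0.\<close>
        have s: "up (x + y) = up x + up y"
        proof (rule ccontr)
          assume "up (x + y) \<noteq> up x + up y"
          then consider "up (x + y) + 1 \<le> up x + up y" | "up x + up y + 1 \<le> up (x + y)"
            by linarith
          then show False
          proof cases
            case 1
            from mult_le_mono1[OF this, of L] show False
              using e' r by (simp add: L_def algebra_simps)
          next
            case 2
            from mult_le_mono1[OF this, of L] show False
              using e' r by (simp add: L_def algebra_simps)
          qed
        qed
        have "\<psi> (up x) = \<psi> (up y)" "\<psi> (up x + up y) = \<psi> (up x)"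
          using his eq eq' s by (auto simp: \<phi>_def)
        moreover have "1 \<le> up x" "1 \<le> up y" "up x + up y \<le> b"
          using up_range[OF his(1) x] up_range[OF his(2) y] up_range[OF his(3) z] s by auto
        ultimately show False
          using \<psi> unfolding schur_colouring_def by blast
      qed
    qed
  qed
  then show ?thesis by blast
qed

text \<open>An explicit partition into four sum-free classes, checked by evaluation; 44 is the Schur
  number for four colours.\<close>

lemma schur_colouring_44: "\<exists>\<chi>. schur_colouring 4 44 \<chi>"
proof -
  define A :: "nat list list" where "A =
    [[1, 3, 5, 15, 17, 19, 26, 28, 40, 42, 44],
     [2, 7, 8, 18, 21, 24, 27, 37, 38, 43],
     [4, 6, 13, 20, 22, 23, 25, 30, 32, 39, 41],
     [9, 10, 11, 12, 14, 16, 29, 31, 33, 34, 35, 36]]"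
  define \<chi> where "\<chi> x = (LEAST c. c < 4 \<and> x \<in> set (A ! c))" for x
  have cover: "list_all (\<lambda>x. list_ex (\<lambda>c. x \<in> set (A ! c)) [0, 1, 2, 3]) [1..<45]"
    unfolding A_def by code_simp
  have sum_free: "list_all (\<lambda>c. list_all (\<lambda>x. list_all (\<lambda>y. x + y \<notin> set (A ! c)) (A ! c)) (A ! c)) [0, 1, 2, 3]"
    unfolding A_def by code_simp
  have \<chi>: "\<chi> x < 4 \<and> x \<in> set (A ! \<chi> x)" if "1 \<le> x" "x \<le> 44" for x
    unfolding \<chi>_def
  proof (rule LeastI_ex)
    have "x \<in> set [1..<45]" using that by simp
    then have "list_ex (\<lambda>c. x \<in> set (A ! c)) [0, 1, 2, 3]"
      using cover unfolding list_all_iff by blast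
    then show "\<exists>c<4. x \<in> set (A ! c)"
      by (auto simp del: One_nat_def) (meson zero_less_numeral one_less_numeral_iff numeral_less_iff semiring_norm)+
  qed
  have "x + y \<notin> set (A ! c)" if "c < 4" "x \<in> set (A ! c)" "y \<in> set (A ! c)" for c x y
  proof -
    have "c \<in> set [0, 1, 2, 3]" using that(1) by auto
    then show ?thesis using sum_free that(2,3) unfolding list_all_iff by blast
  qed
  then have "schur_colouring 4 44 \<chi>"
    unfolding schur_colouring_def using \<chi> by (metis atLeastAtMost_iff add_leE trans_le_add1)
  then show ?thesis by blast
qed

text \<open>The product construction multiplies the values \<open>2 * M + 1\<close>: from 89 come
  \<open>89 ^ 2 = 2 * 3960 + 1\<close> and \<open>89 ^ 3 = 2 * 352484 + 1\<close>.\<close>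

lemma schur_colouring_352484: "\<exists>\<chi>. schur_colouring 12 352484 \<chi>"
proof -
  obtain \<chi> where \<chi>: "schur_colouring 4 44 \<chi>"
    using schur_colouring_44 ..
  obtain \<psi> where "schur_colouring 8 3960 \<psi>"
    using schur_colouring_product[OF \<chi> \<chi>] by auto
  from schur_colouring_product[OF \<chi> this] show ?thesis by simp
qed

section \<open>Points with sparse digits\<close>

text \<open>With base \<open>4 * (M + 1)\<close> and digits at most \<open>M\<close>, the lower digits perturb a multiple of
  \<open>B ^ l\<close> by less than \<open>B ^ l / 4\<close>, small enough for the leading digits of the three differences
  in a triangle to add up exactly.\<close>

lemma sparse_digit_points:
  fixes B :: real
  assumes B_def: "B = 4 * (real M + 1)"
  shows "\<exists>X::real set. finite X \<and> card X = (M + 1) ^ k \<and> (\<forall>x\<in>X. 0 \<le> x \<and> x < B ^ k / 4) \<and>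
    (\<forall>x\<in>X. \<forall>y\<in>X. x \<noteq> y \<longrightarrow>
       (\<exists>l<k. \<exists>s\<in>{1..M}. \<bar>\<bar>x - y\<bar> - real s * B ^ l\<bar> < B ^ l / 4))"
proof (induction k)
  case 0
  show ?case by (intro exI[of _ "{0}"]) auto
next
  case (Suc k)
  then obtain X :: "real set" where X: "finite X" "card X = (M + 1) ^ k"
    and bd: "\<And>x. x \<in> X \<Longrightarrow> 0 \<le> x \<and> x < B ^ k / 4"
    and sep: "\<And>x y. x \<in> X \<Longrightarrow> y \<in> X \<Longrightarrow> x \<noteq> y \<Longrightarrow>
       \<exists>l<k. \<exists>s\<in>{1..M}. \<bar>\<bar>x - y\<bar> - real s * B ^ l\<bar> < B ^ l / 4"
    by metis
  have Bk: "B ^ k > 0" by (simp add: B_def)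
  \<comment> \<open>\<open>a\<close> becomes the new leading digit, at position \<open>k\<close>;
    the bound \<open>x < B ^ k / 4\<close> keeps differences of the tails below
    \<open>B ^ k / 4\<close>.\<close>
  define f where "f = (\<lambda>(a, x). real a * B ^ k + x :: real)"
  define Y where "Y = f ` ({..M} \<times> X)"
  have near: "\<bar>\<bar>f (a, x) - f (b, y)\<bar> - \<bar>real a - real b\<bar> * B ^ k\<bar> < B ^ k / 4"
    if "x \<in> X" "y \<in> X" for a b x y
  proof -
    have "\<bar>real a - real b\<bar> * B ^ k = \<bar>real a * B ^ k - real b * B ^ k\<bar>"
      using Bk by (simp add: left_diff_distrib[symmetric] abs_mult)
    moreover have "\<bar>x - y\<bar> < B ^ k / 4"
      using bd[OF that(1)] bd[OF that(2)] by linarith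
    ultimately show ?thesis unfolding f_def prod.case by linarith
  qed
  have far: "\<exists>s\<in>{1..M}. \<bar>\<bar>f (a, x) - f (b, y)\<bar> - real s * B ^ k\<bar> < B ^ k / 4"
    if "x \<in> X" "y \<in> X" "a \<le> M" "b \<le> M" "a \<noteq> b" for a b x y
  proof (intro bexI)
    define s where "s = (if a < b then b - a else a - b)"
    have "real s = \<bar>real a - real b\<bar>" using that by (auto simp: s_def of_nat_diff)
    with near[OF that(1,2), of a b]
    show "\<bar>\<bar>f (a, x) - f (b, y)\<bar> - real s * B ^ k\<bar> < B ^ k / 4" by simp
    show "s \<in> {1..M}" using that by (auto simp: s_def)
  qed
  have inj: "inj_on f ({..M} \<times> X)"
  proof (rule inj_onI)
    fix u v assume uv: "u \<in> {..M} \<times> X" "v \<in> {..M} \<times> X" "f u = f v"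
    then obtain a x b y where e: "u = (a, x)" "v = (b, y)"
      and *: "a \<in> {..M}" "x \<in> X" "b \<in> {..M}" "y \<in> X" "f (a, x) = f (b, y)"
      by blast
    have "a = b"
    proof (rule ccontr)
      assume "a \<noteq> b"
      with far[of x y a b] * obtain s where s: "1 \<le> s" "\<bar>real s * B ^ k\<bar> < B ^ k / 4" by auto
      have "1 * B ^ k \<le> real s * B ^ k" using s(1) Bk by (intro mult_right_mono) auto
      with s(2) Bk show False by linarith
    qed
    with *(5) e show "u = v" by (simp add: f_def)
  qed
  show ?case
  proof (intro exI[of _ Y] conjI ballI impI)
    show "finite Y" using X(1) by (simp add: Y_def)
    show "card Y = (M + 1) ^ Suc k"
      using X by (simp add: Y_def card_image[OF inj] card_cartesian_product)
  next
    fix y assume "y \<in> Y"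
    then obtain a x where y: "a \<le> M" "x \<in> X" "y = real a * B ^ k + x"
      by (auto simp: Y_def f_def)
    show "0 \<le> y" using y bd[of x] Bk by simp
    \<comment> \<open>\<open>B ^ Suc k / 4\<close> equals \<open>(M + 1) * B ^ k\<close>, which has
      room for the digit \<open>M\<close> and a tail.\<close>
    have "real a * B ^ k \<le> real M * B ^ k" using y(1) Bk by (intro mult_right_mono) auto
    moreover have "B ^ Suc k = 4 * (real M * B ^ k) + 4 * B ^ k"
      by (simp add: B_def algebra_simps)
    ultimately show "y < B ^ Suc k / 4"
      using y(3) bd[OF y(2)] Bk by linarith
  next
    fix u v assume "u \<in> Y" "v \<in> Y" "u \<noteq> v"
    then obtain a x b y where *: "a \<le> M" "x \<in> X" "u = f (a, x)" "b \<le> M" "y \<in> X" "v = f (b, y)"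
      by (auto simp: Y_def)
    show "\<exists>l<Suc k. \<exists>s\<in>{1..M}. \<bar>\<bar>u - v\<bar> - real s * B ^ l\<bar> < B ^ l / 4"
    proof (cases "a = b")
      case True
      then have "u - v = x - y" "x \<noteq> y" using * \<open>u \<noteq> v\<close> by (auto simp: f_def)
      then show ?thesis using sep[of x y] * by (auto intro: less_SucI)
    next
      case False
      then show ?thesis using far[of x y a b] * by auto
    qed
  qed
qed

text \<open>Digits in \<open>{1..M}\<close> at position \<open>l\<close> place \<open>u\<close>
  between \<open>B ^ l / 2\<close> and \<open>(M + 1/2) * B ^ l\<close>, and these ranges are
  disjoint for distinct positions. At one position distinct multiples are \<open>B ^ l\<close>
  apart, more than the two tolerances together.\<close>

lemma scale_unique:
  fixes B u :: real
  assumes B: "B = 4 * (real M + 1)"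
    and s: "s \<in> {1..M}" "\<bar>u - real s * B ^ l\<bar> < B ^ l / 2"
    and s': "s' \<in> {1..M}" "\<bar>u - real s' * B ^ l'\<bar> < B ^ l' / 4"
  shows "l' = l" "s' = s"
proof -
  have B1: "B \<ge> 1" by (simp add: B)
  have pos: "B ^ i > 0" for i by (simp add: B)
  have lower: "B ^ i \<le> real r * B ^ i" if "r \<in> {1..M}" for r i
    using that pos[of i] mult_right_mono[of 1 "real r" "B ^ i"] by simp
  have upper: "real r * B ^ i \<le> real M * B ^ i" if "r \<in> {1..M}" for r i
    using that pos[of i] by (intro mult_right_mono) auto
  have step: "4 * (real M * B ^ i) + 4 * B ^ i \<le> B ^ j" if "i < j" for i j
  proof -
    have "B ^ Suc i \<le> B ^ j" using that B1 by (intro power_increasing) auto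
    then show ?thesis by (simp add: B algebra_simps)
  qed
  show l: "l' = l"
  proof (rule linorder_cases[of l l'])
    assume "l < l'"
    have "0 \<le> real M * B ^ l" using pos[of l] by simp
    then show "l' = l"
      using step[OF \<open>l < l'\<close>] s s' lower[OF s'(1), of l'] upper[OF s(1), of l] pos[of l] by linarith
  next
    assume "l' < l"
    have "0 \<le> real M * B ^ l'" using pos[of l'] by simp
    then show "l' = l"
      using step[OF \<open>l' < l\<close>] s s' lower[OF s(1), of l] upper[OF s'(1), of l'] pos[of l'] by linarith
  qed auto
  show "s' = s"
  proof (rule ccontr)
    assume "s' \<noteq> s"
    then have "1 * B ^ l \<le> \<bar>real s' - real s\<bar> * B ^ l"
      using pos[of l] by (intro mult_right_mono) auto
    also have "\<dots> = \<bar>real s' * B ^ l - real s * B ^ l\<bar>"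
      using pos[of l] by (simp add: left_diff_distrib[symmetric] abs_mult)
    finally show False using s s' l pos[of l] by (simp add: abs_if split: if_splits)
  qed
qed

lemma card_3_ordered:
  fixes S :: "'a::linorder set"
  assumes "card S = 3"
  obtains x y z where "S = {x, y, z}" "x < y" "y < z"
proof -
  obtain a b c where "S = {a, b, c}" "a \<noteq> b" "b \<noteq> c" "a \<noteq> c"
    using assms by (auto simp: card_3_iff)
  then show ?thesis
    using that by (metis insert_commute neqE)
qed

text \<open>For \<open>x < y < z\<close> the distances add up, and so do the leading digit
  differences: they form a Schur triple in the colour \<open>c\<close>.\<close>

lemma no_near_triangle:
  fixes B :: real
  assumes \<chi>: "schur_colouring n M \<chi>" and B: "B = 4 * (real M + 1)"
    and X: "\<And>x y. x \<in> X \<Longrightarrow> y \<in> X \<Longrightarrow> x \<noteq> y \<Longrightarrow>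
       \<exists>l s. s \<in> {1..M} \<and> \<bar>\<bar>x - y\<bar> - real s * B ^ l\<bar> < B ^ l / 4"
    and xyz: "x \<in> X" "y \<in> X" "z \<in> X" "x < y" "y < z"
    and near: "near_multiple {s \<in> {1..M}. \<chi> s = c} (B ^ l) \<bar>x - y\<bar>"
      "near_multiple {s \<in> {1..M}. \<chi> s = c} (B ^ l) \<bar>y - z\<bar>"
      "near_multiple {s \<in> {1..M}. \<chi> s = c} (B ^ l) \<bar>x - z\<bar>"
  shows False
proof -
  \<comment> \<open>Three errors of \<open>B ^ l / 2\<close> would be too large for exact addition;
    \<open>scale_unique\<close> sharpens each to the \<open>B ^ l / 4\<close> known for points of
    \<open>X\<close>.\<close>
  have refine: "\<exists>s\<in>{1..M}. \<chi> s = c \<and> \<bar>\<bar>u - v\<bar> - real s * B ^ l\<bar> < B ^ l / 4"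
    if uv: "u \<in> X" "v \<in> X" "u \<noteq> v" "near_multiple {s \<in> {1..M}. \<chi> s = c} (B ^ l) \<bar>u - v\<bar>" for u v
  proof -
    obtain s where s: "s \<in> {1..M}" "\<chi> s = c" "\<bar>\<bar>u - v\<bar> - real s * B ^ l\<bar> < B ^ l / 2"
      using uv(4) by (auto simp: near_multiple_def)
    obtain l' s' where s': "s' \<in> {1..M}" "\<bar>\<bar>u - v\<bar> - real s' * B ^ l'\<bar> < B ^ l' / 4"
      using X[OF uv(1-3)] by blast
    from scale_unique[OF B s(1,3) s'] s s' show ?thesis by auto
  qed
  have pos: "B ^ l > 0" by (simp add: B)
  obtain s1 where s1: "s1 \<in> {1..M}" "\<chi> s1 = c" "\<bar>\<bar>x - y\<bar> - real s1 * B ^ l\<bar> < B ^ l / 4"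
    using refine[of x y] xyz near(1) by auto
  obtain s2 where s2: "s2 \<in> {1..M}" "\<chi> s2 = c" "\<bar>\<bar>y - z\<bar> - real s2 * B ^ l\<bar> < B ^ l / 4"
    using refine[of y z] xyz near(2) by auto
  obtain s3 where s3: "s3 \<in> {1..M}" "\<chi> s3 = c" "\<bar>\<bar>x - z\<bar> - real s3 * B ^ l\<bar> < B ^ l / 4"
    using refine[of x z] xyz near(3) by auto
  \<comment> \<open>The three errors total less than \<open>3/4 * B ^ l\<close>, while distinct
    integers would give a gap of at least \<open>B ^ l\<close>.\<close>
  have "s1 + s2 = s3"
  proof (rule ccontr)
    assume "s1 + s2 \<noteq> s3"
    then have "1 * B ^ l \<le> \<bar>real (s1 + s2) - real s3\<bar> * B ^ l"
      using pos by (intro mult_right_mono) auto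
    also have "\<dots> = \<bar>real s1 * B ^ l + real s2 * B ^ l - real s3 * B ^ l\<bar>"
      using pos by (simp add: left_diff_distrib[symmetric] distrib_right[symmetric] abs_mult)
    finally show False using s1(3) s2(3) s3(3) xyz pos by (simp add: abs_if split: if_splits)
  qed
  then have "\<chi> s1 = \<chi> s2" "\<chi> (s1 + s2) = \<chi> s1" "1 \<le> s1" "1 \<le> s2" "s1 + s2 \<le> M"
    using s1 s2 s3 by auto
  then show False
    using \<chi> unfolding schur_colouring_def by blast
qed

section \<open>The Ramsey bound\<close>

text \<open>The \<open>m\<close> colours provide \<open>m div n\<close> digit positions with
  \<open>n\<close> Schur colours each.\<close>

lemma not_semialg_ramsey_property:
  assumes \<chi>: "schur_colouring n M \<chi>" and M: "M < t * (t div 4)" and d: "d \<ge> 1"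
    and N: "N \<le> (M + 1) ^ (m div n)"
  shows "\<not> semialg_ramsey_property d t m N"
proof
  assume RP: "semialg_ramsey_property d t m N"
  define B where "B = 4 * (real M + 1)"
  have pos: "B ^ l > 0" for l by (simp add: B_def)
  obtain X :: "real set" where X: "finite X" "card X = (M + 1) ^ (m div n)"
    and sep: "\<And>x y. x \<in> X \<Longrightarrow> y \<in> X \<Longrightarrow> x \<noteq> y \<Longrightarrow>
       \<exists>l<m div n. \<exists>s\<in>{1..M}. \<bar>\<bar>x - y\<bar> - real s * B ^ l\<bar> < B ^ l / 4"
    using sparse_digit_points[OF B_def, of "m div n"] by metis
  have sep': "\<exists>l s. s \<in> {1..M} \<and> \<bar>\<bar>x - y\<bar> - real s * B ^ l\<bar> < B ^ l / 4"
    if "x \<in> X" "y \<in> X" "x \<noteq> y" for x y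
    using sep[OF that] by blast
  \<comment> \<open>The minimum can only be bounded if every smaller \<open>N\<close> fails too, so
    a subset of exactly \<open>N\<close> points is taken.\<close>
  obtain Y where Y: "Y \<subseteq> X" "card Y = N" "finite Y"
    using N X obtain_subset_with_card_n[of N X] by (metis finite_subset)
  define p where "p x = vec d (\<lambda>_. x)" for x :: real
  have p0 [simp]: "p x $ 0 = x" for x using d by (simp add: p_def)
  have p_inj: "p x = p y \<longleftrightarrow> x = y" for x y by (metis p0)
  define ps where "ps = map p (sorted_list_of_set Y)"
  have set_ps: "set ps = p ` Y" using Y by (simp add: ps_def)
  have ps: "distinct ps" "length ps = N" "set ps \<subseteq> carrier_vec d"
    using Y by (auto simp: ps_def distinct_map inj_on_def p_inj, simp add: p_def)
  define A where "A c = {s \<in> {1..M}. \<chi> s = c}" for c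
  \<comment> \<open>Position \<open>l\<close> and Schur colour \<open>c\<close> are encoded as
    \<open>i = l * n + c + 1\<close>, as indices start at 1. Leftover indices up to \<open>m\<close>
    give relations of the same form, covered by the same triangle argument.\<close>
  define E where "E i = dist_relation (set ps) (A ((i - 1) mod n)) (B ^ ((i - 1) div n))" for i
  have edge: "{p x, p y} \<in> E i \<longleftrightarrow> near_multiple (A ((i - 1) mod n)) (B ^ ((i - 1) div n)) \<bar>x - y\<bar>"
    if "x \<in> Y" "y \<in> Y" "x \<noteq> y" for x y i
    using that by (simp add: E_def dist_relation_iff set_ps p_inj)
  have E_sub: "E i \<subseteq> [set ps]\<^bsup>2\<^esup>" for i
    by (auto simp: E_def dist_relation_def nsets_def)
  have cover: "[set ps]\<^bsup>2\<^esup> = (\<Union>i\<in>{1..m}. E i)"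
  proof (intro equalityI subsetI)
    fix e assume "e \<in> [set ps]\<^bsup>2\<^esup>"
    then obtain u v where "e = {u, v}" "u \<noteq> v" "u \<in> p ` Y" "v \<in> p ` Y"
      by (auto simp: nsets_def card_2_iff set_ps)
    then obtain x y where e: "e = {p x, p y}" and xy: "x \<in> Y" "y \<in> Y" "x \<noteq> y"
      by blast
    then obtain l s where l: "l < m div n" and s: "s \<in> {1..M}"
      "\<bar>\<bar>x - y\<bar> - real s * B ^ l\<bar> < B ^ l / 4"
      using sep[of x y] Y(1) by blast
    have c: "\<chi> s < n" using \<chi> s(1) by (auto simp: schur_colouring_def)
    define i where "i = l * n + \<chi> s + 1"
    have i: "(i - 1) mod n = \<chi> s" "(i - 1) div n = l"
      using c by (auto simp: i_def)
    have "i \<le> (l + 1) * n" using c by (simp add: i_def)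
    also have "\<dots> \<le> m div n * n" using l by (intro mult_right_mono) auto
    also have "\<dots> \<le> m" by simp
    finally have "i \<in> {1..m}" by (simp add: i_def)
    moreover have "near_multiple (A (\<chi> s)) (B ^ l) \<bar>x - y\<bar>"
      unfolding near_multiple_def using s pos[of l] by (intro bexI[of _ s]) (auto simp: A_def)
    then have "e \<in> E i"
      unfolding e edge[OF xy] i .
    ultimately show "e \<in> (\<Union>i\<in>{1..m}. E i)" by blast
  qed (use E_sub in blast)
  have "symmetric_semialg d t ps (E i)" for i
    unfolding E_def using M by (intro dist_relation_symmetric_semialg d ps pos) (auto simp: A_def)
  with RP ps cover obtain T i where T: "T \<in> [set ps]\<^bsup>3\<^esup>" "[T]\<^bsup>2\<^esup> \<subseteq> E i"
    unfolding semialg_ramsey_property_def by blast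
  from T(1) have T': "T \<subseteq> p ` Y" "card T = 3" by (auto simp: nsets_def set_ps)
  then obtain Z where Z: "Z \<subseteq> Y" "T = p ` Z"
    by (auto simp: subset_image_iff)
  have "card Z = 3"
    using T'(2) Z by (simp add: card_image inj_on_def p_inj)
  then obtain x y z where xyz: "Z = {x, y, z}" "x < y" "y < z"
    by (rule card_3_ordered)
  have "{p u, p v} \<in> E i" if "u \<in> Z" "v \<in> Z" "u \<noteq> v" for u v
    using T(2) that Z by (auto simp: nsets_def p_inj)
  then have near: "near_multiple (A ((i - 1) mod n)) (B ^ ((i - 1) div n)) \<bar>u - v\<bar>"
    if "u \<in> Z" "v \<in> Z" "u \<noteq> v" for u v
    using edge[of u v i] that Z(1) by blast
  show False
  proof (rule no_near_triangle[OF \<chi> B_def sep', where c = "(i - 1) mod n" and l = "(i - 1) div n"])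
    show "x \<in> X" "y \<in> X" "z \<in> X" using xyz Z Y by auto
    show "x < y" "y < z" by fact+
  qed (use near[of x y] near[of y z] near[of x z] xyz in \<open>simp_all add: A_def\<close>)
qed

text \<open>The minimum has the Ramsey property, which fails for every \<open>N\<close> up to the
  given power.\<close>

lemma semialg_ramsey_gt:
  assumes "schur_colouring n M \<chi>" "M < t * (t div 4)" "d \<ge> 1"
  shows "semialg_ramsey d t m > (M + 1) ^ (m div n)"
proof (rule ccontr)
  assume "\<not> ?thesis"
  moreover have "semialg_ramsey_property d t m (semialg_ramsey d t m)"
    unfolding semialg_ramsey_def using semialg_ramsey_property_ex by (rule LeastI_ex)
  ultimately show False
    using not_semialg_ramsey_property[OF assms] by simp
qed

theorem theorem7:
  shows "\<exists>c::real. c > 0 \<and>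
    (\<forall>d t m :: nat. d \<ge> 1 \<and> t \<ge> 5000 \<and> m \<ge> 1 \<longrightarrow>
       real (semialg_ramsey d t m) \<ge> c * 1681 powr (real m / 7) \<and>
       c * 1681 powr (real m / 7) \<ge> c * 2.889 ^ m)"
proof (intro exI[of _ "1 / 352485"] conjI allI impI)
  let ?b = "1681 powr (1 / 7) :: real"
  have b: "?b ^ 7 = 1681" "?b > 0"
    by (simp_all add: powr_power)
  have b_m: "1681 powr (real m / 7) = ?b ^ m" for m
    by (simp add: powr_power)
  \<comment> \<open>Seventh powers turn this into \<open>1681 ^ 12 \<le> 352485 ^ 7\<close>.\<close>
  have b12: "?b ^ 12 \<le> 352485"
  proof (rule power_le_imp_le_base)
    have "(?b ^ 12) ^ Suc 6 = (?b ^ 7) ^ 12" by (simp flip: power_mult)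
    then show "(?b ^ 12) ^ Suc 6 \<le> 352485 ^ Suc 6" unfolding b by simp
  qed simp
  have b_ge: "2.889 \<le> ?b"
  proof (rule power_le_imp_le_base)
    show "2.889 ^ Suc 6 \<le> ?b ^ Suc 6"
      using b(1) by (simp add: power_divide)
  qed (use b in simp)
  fix d t m :: nat
  assume "d \<ge> 1 \<and> t \<ge> 5000 \<and> m \<ge> 1"
  then have d: "d \<ge> 1" and t: "t \<ge> 5000" by auto
  show "1 / 352485 * 1681 powr (real m / 7) \<ge> 1 / 352485 * 2.889 ^ m"
    unfolding b_m by (intro mult_left_mono power_mono b_ge) auto
  obtain \<chi> where \<chi>: "schur_colouring 12 352484 \<chi>"
    using schur_colouring_352484 ..
  \<comment> \<open>The product is 6250000, well above the 352484 digit differences to be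
    recognised.\<close>
  have "5000 * 1250 \<le> t * (t div 4)"
    using t by (intro mult_le_mono) auto
  then have "352485 ^ (m div 12) < semialg_ramsey d t m"
    using semialg_ramsey_gt[OF \<chi> _ d, of t m] by simp
  then have R: "352485 ^ (m div 12) \<le> real (semialg_ramsey d t m)"
    by (metis less_imp_le of_nat_le_iff of_nat_numeral of_nat_power)
  \<comment> \<open>Rounding \<open>m\<close> to a multiple of 12 costs at most one factor
    \<open>?b ^ 12 \<le> 352485\<close>, which the constant \<open>1 / 352485\<close>
    absorbs.\<close>
  have "?b ^ m \<le> ?b ^ (12 * (m div 12) + 12)"
    using b_ge by (intro power_increasing) (linarith, simp)
  also have "\<dots> = (?b ^ 12) ^ (m div 12) * ?b ^ 12"
    by (simp only: power_add power_mult)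
  also have "\<dots> \<le> 352485 ^ (m div 12) * 352485"
    by (intro mult_mono power_mono b12) auto
  also have "\<dots> \<le> real (semialg_ramsey d t m) * 352485"
    using R by simp
  finally show "real (semialg_ramsey d t m) \<ge> 1 / 352485 * 1681 powr (real m / 7)"
    unfolding b_m by simp
qed simp

end
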